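(* Let $G=(P,E)$ be a finite graph with a legal coloring $col:P\to\{1,2,3,\dots\}$ (adjacent nodes receive different colors). For each holiday $i=1,2,3,\dots$, declare a node $p$ with color $c=col(p)$ happy at holiday $i$ if and only if the $|\omega(c)|$ least significant bits of the binary representation of $i$ (padded with leading zeros if necessary), read from most to least significant, equal the reversal $\omega(c)^R$ of the Elias omega code $\omega(c)$ of $c$. Then for every node $p$ with color $c$, in every sequence of $\phi(c)\cdot 2^{\log^* c+1}$ consecutive holidays, $p$ is happy at least once.
   Context: Logarithms are base 2. For a positive integer $n$, $B(n)$ is the binary representation of $n$ without leading zeros. The Elias omega code is defined by: $re(1)=\lambda$ (the empty string) and, for $i>1$, $re(i)=re(|B(i)|-1)\circ B(i)$ where $\circ$ is concatenation and $|B(i)|$ is the number of bits of $B(i)$; then $\omega(i)=re(i)\circ 0$. For a string $S$, $S^R$ is $S$ reversed. The function $\phi$ is defined on reals by $\phi(x)=1$ if $x\le 1$ and $\phi(x)=x\cdot\phi(\log x)$ if $x>1$ (so $\phi(c)=c\cdot\log c\cdot\log\log c\cdots$). $\log^* c$ is the least $k\ge 0$ such that the $k$-fold iterated logarithm of $c$ is at most $1$. *)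

theory Defs
  imports Complex_Main "HOL-Library.Ramsey"
begin

definition finite_graph :: "'a set \<Rightarrow> 'a set set \<Rightarrow> bool" where
  "finite_graph P E \<longleftrightarrow> finite P \<and> E \<subseteq> [P]\<^bsup>2\<^esup>"

definition legal_coloring :: "'a set \<Rightarrow> 'a set set \<Rightarrow> ('a \<Rightarrow> nat) \<Rightarrow> bool" where
  "legal_coloring P E col \<longleftrightarrow>
     (\<forall>p\<in>P. col p \<ge> 1) \<and> (\<forall>u v. {u, v} \<in> E \<longrightarrow> col u \<noteq> col v)"

text \<open>Bit strings are lists with the most significant bit first; \<open>True\<close> is the bit 1.\<close>

fun binary :: "nat \<Rightarrow> bool list" where
  "binary n = (if n = 0 then [] else binary (n div 2) @ [odd n])"

declare binary.simps [simp del]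

lemma length_binary_le: "length (binary n) \<le> n"
proof (induction n rule: less_induct)
  case (less n)
  show ?case
  proof (cases "n = 0")
    case False
    then have "length (binary (n div 2)) \<le> n div 2" using less by simp
    with False show ?thesis by (subst binary.simps) simp
  qed (simp add: binary.simps)
qed

text \<open>The value at 0 is irrelevant: the code is only used for positive numbers, and
  the recursion from a positive number never reaches 0.\<close>

function elias_re :: "nat \<Rightarrow> bool list" where
  "elias_re i = (if i \<le> 1 then [] else elias_re (length (binary i) - 1) @ binary i)"
  by auto
termination
proof (relation "measure id", goal_cases)
  case (2 i)
  with length_binary_le[of i] have "length (binary i) - 1 < i" by linarith
  then show ?case by simp
qed simp

declare elias_re.simps [simp del]

definition omega :: "nat \<Rightarrow> bool list" where
  "omega i = elias_re i @ [False]"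

definition least_significant_bits :: "nat \<Rightarrow> nat \<Rightarrow> bool list" where
  "least_significant_bits m i =
     (let w = replicate (m - length (binary i)) False @ binary i
      in drop (length w - m) w)"

definition happy :: "('a \<Rightarrow> nat) \<Rightarrow> 'a \<Rightarrow> nat \<Rightarrow> bool" where
  "happy col p i \<longleftrightarrow>
     least_significant_bits (length (omega (col p))) i = rev (omega (col p))"

lemma nat_ceiling_log_less:
  fixes x :: real
  assumes "x > 1"
  shows "nat \<lceil>log 2 x\<rceil> < nat \<lceil>x\<rceil>"
proof -
  define n where "n = nat \<lceil>x\<rceil>"
  have xn: "x \<le> real n" unfolding n_def by linarith
  have n: "n \<ge> 2" using assms unfolding n_def by linarith
  then obtain m where m: "n = Suc m" by (cases n) auto
  have "Suc m \<le> 2 ^ m" by (simp add: Suc_leI less_exp)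
  then have "real n \<le> 2 ^ m" unfolding m by (metis of_nat_le_numeral_power_cancel_iff)
  with xn have "x \<le> 2 ^ m" by linarith
  then have "x \<le> 2 powr real m" by (simp add: powr_realpow)
  then have "log 2 x \<le> real m" using assms by (simp add: log_le_iff)
  then have "nat \<lceil>log 2 x\<rceil> \<le> m" by linarith
  then show ?thesis using n_def m by linarith
qed

function phi :: "real \<Rightarrow> real" where
  "phi x = (if x \<le> 1 then 1 else x * phi (log 2 x))"
  by auto
termination
  by (relation "measure (\<lambda>x. nat \<lceil>x\<rceil>)") (use nat_ceiling_log_less in auto)

declare phi.simps [simp del]

text \<open>All iterates before the least such \<open>k\<close> exceed 1, so the logarithm is only ever
  applied to positive arguments.\<close>

definition log_star :: "real \<Rightarrow> nat" where
  "log_star x = (LEAST k. (log 2 ^^ k) x \<le> 1)"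

end

theory Submission imports Defs begin

text \<open>
  A node of color \<open>c\<close> is happy exactly on one residue class modulo \<open>2 ^ |\<omega>(c)|\<close>, so it suffices
  to show \<open>2 ^ |\<omega>(c)| \<le> \<phi>(c) * 2 ^ (log\<^sup>* c + 1)\<close>. Each stage of the recursion for \<open>re(i)\<close>
  contributes a factor \<open>2 ^ |B(i)| \<le> 2 * i\<close>, and passes from \<open>i\<close> to \<open>\<lfloor>log i\<rfloor>\<close>. Bounding \<open>2 ^ |re(i)|\<close>
  by \<open>\<phi>(x) * 2 ^ log\<^sup>* x\<close> for every real \<open>x \<ge> i\<close> absorbs the rounding in the induction.
\<close>

lemma least_significant_bits_0 [simp]: "least_significant_bits 0 i = []"
  by (simp add: least_significant_bits_def)

text \<open>Peeling off the last bit matches the recursion of \<open>binary\<close>. For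
  \<open>i = 0\<close> the peeled bit comes from the zero padding, since \<open>binary 0\<close> is
  empty.\<close>

lemma least_significant_bits_Suc:
  "least_significant_bits (Suc m) i = least_significant_bits m (i div 2) @ [odd i]"
proof (cases "i = 0")
  case True
  then show ?thesis
    by (simp add: least_significant_bits_def binary.simps[of 0] replicate_append_same)
next
  case False
  then have "binary i = binary (i div 2) @ [odd i]"
    by (subst binary.simps) simp
  then show ?thesis
    by (simp add: least_significant_bits_def Let_def)
qed

text \<open>The residue \<open>r\<close> is the number that \<open>w\<close> spells in binary.
  Appending a bit \<open>b\<close> at the least significant end turns \<open>r\<close> into
  \<open>2 * r + of_bool b\<close> and doubles the modulus.\<close>

lemma least_significant_bits_eq_if_mod:
  "\<exists>r < 2 ^ length w. \<forall>i. i mod 2 ^ length w = r \<longrightarrow> least_significant_bits (length w) i = w"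
proof (induction w rule: rev_induct)
  case Nil
  then show ?case by simp
next
  case (snoc b w)
  then obtain r where r: "r < 2 ^ length w"
    and bits: "\<And>i. i mod 2 ^ length w = r \<Longrightarrow> least_significant_bits (length w) i = w"
    by blast
  have "least_significant_bits (Suc (length w)) i = w @ [b]"
    if i: "i mod (2 * 2 ^ length w) = 2 * r + of_bool b" for i
  proof -
    have split: "2 * (i div 2 mod 2 ^ length w) + i mod 2 = 2 * r + of_bool b"
      using i by (simp add: mod_mult2_eq)
    \<comment> \<open>Comparing parities in \<open>split\<close> isolates the last bit; cancelling
      it and halving leaves the residue of \<open>i div 2\<close>.\<close>
    have odd: "odd i = b"
      using arg_cong[OF split, of odd] by (cases b) auto
    with split have "i div 2 mod 2 ^ length w = r"
      by (cases b) (auto simp: odd_iff_mod_2_eq_one)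
    with bits odd show ?thesis
      by (simp add: least_significant_bits_Suc)
  qed
  moreover have "2 * r + of_bool b < 2 * 2 ^ length w"
    using r by (cases b) auto
  ultimately show ?case
    by (intro exI[of _ "2 * r + of_bool b"]) auto
qed

lemma ex_mod_eq_in_interval:
  fixes m r s :: nat
  assumes "r < m"
  shows "\<exists>i\<in>{s..<s + m}. i mod m = r"
proof -
  \<comment> \<open>This is \<open>r - s\<close> modulo \<open>m\<close>, with
    \<open>m - s mod m\<close> standing for \<open>-s\<close> to avoid truncated
    subtraction.\<close>
  let ?d = "(r + (m - s mod m)) mod m"
  have "s mod m < m" using assms by simp
  have "(s + ?d) mod m = (s mod m + (r + (m - s mod m))) mod m"
    by (simp add: mod_simps)
  also have "s mod m + (r + (m - s mod m)) = r + m"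
    using \<open>s mod m < m\<close> by simp
  finally have "(s + ?d) mod m = r"
    using assms by simp
  moreover have "?d < m" using assms by simp
  ultimately show ?thesis
    by (intro bexI[of _ "s + ?d"]) auto
qed

lemma two_power_length_binary_le:
  "n > 0 \<Longrightarrow> 2 ^ length (binary n) \<le> 2 * n"
proof (induction n rule: less_induct)
  case (less n)
  have step: "length (binary n) = Suc (length (binary (n div 2)))"
    using less.prems by (subst binary.simps) simp
  show ?case
  proof (cases "n = 1")
    case True
    with step show ?thesis by (simp add: binary.simps[of 0])
  next
    case False
    with less.prems have "2 ^ length (binary (n div 2)) \<le> 2 * (n div 2)"
      by (intro less.IH) auto
    with step show ?thesis by simp
  qed
qed

lemma length_binary_pos: "n > 0 \<Longrightarrow> length (binary n) > 0"
  by (subst binary.simps) simp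

lemma phi_ge_1: "1 \<le> phi x"
proof (induction x rule: phi.induct)
  case (1 x)
  then show ?case
    using mult_mono[of 1 x 1 "phi (log 2 x)"] by (subst phi.simps) auto
qed

text \<open>Ensures that the \<open>LEAST\<close> in \<open>log_star\<close> is attained. The
  induction rests on the termination of \<open>phi\<close>, which iterates the same
  logarithm.\<close>

lemma iterated_log_le_1: "\<exists>k. (log 2 ^^ k) x \<le> 1"
proof (induction x rule: phi.induct)
  case (1 x)
  show ?case
  proof (cases "x \<le> 1")
    case True
    then show ?thesis by (intro exI[of _ 0]) simp
  next
    case False
    with 1 obtain k where "(log 2 ^^ k) (log 2 x) \<le> 1" by blast
    then show ?thesis by (intro exI[of _ "Suc k"]) (simp add: funpow_swap1)
  qed
qed

lemma log_star_step:
  assumes "x > 1"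
  shows "log_star x = Suc (log_star (log 2 x))"
proof -
  obtain k where "(log 2 ^^ k) x \<le> 1" using iterated_log_le_1 by blast
  then have "log_star x = Suc (LEAST k. (log 2 ^^ Suc k) x \<le> 1)"
    unfolding log_star_def by (rule Least_Suc) (use assms in simp)
  then show ?thesis by (simp add: log_star_def funpow_swap1)
qed

lemma two_power_length_elias_re_le:
  "real i \<le> x \<Longrightarrow> 2 ^ length (elias_re i) \<le> phi x * 2 ^ log_star x"
proof (induction i arbitrary: x rule: less_induct)
  case (less i)
  show ?case
  proof (cases "i \<le> 1")
    case True
    then show ?thesis
      using mult_mono[of 1 "phi x" 1 "2 ^ log_star x"] phi_ge_1[of x]
      by (simp add: elias_re.simps[of i])
  next
    case False
    define n where "n = length (binary i) - 1"
    have len: "length (binary i) = Suc n"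
      using length_binary_pos[of i] False by (simp add: n_def)
    have x: "x > 1" using False less.prems by linarith
    have "2 ^ n \<le> i"
      using two_power_length_binary_le[of i] False len by simp
    then have "real (2 ^ n) \<le> real i" by (rule of_nat_mono)
    with less.prems have pow: "2 ^ n \<le> x"
      unfolding of_nat_power of_nat_numeral by linarith
    have "n < i" using length_binary_le[of i] len by simp
    moreover have "real n \<le> log 2 x"
      using pow x by (simp add: le_log_iff powr_realpow)
    ultimately have IH: "2 ^ length (elias_re n) \<le> phi (log 2 x) * 2 ^ log_star (log 2 x)"
      by (rule less.IH)
    have "elias_re i = elias_re n @ binary i"
      using False by (subst elias_re.simps) (simp add: n_def)
    \<comment> \<open>Of the \<open>Suc n\<close> bits of \<open>binary i\<close>, the factor
      \<open>x\<close> in \<open>phi x\<close> pays for \<open>n\<close>, and the increment of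
      \<open>log_star\<close> pays for the remaining factor 2.\<close>
    then have "(2::real) ^ length (elias_re i) = 2 * (2 ^ n * 2 ^ length (elias_re n))"
      by (simp add: len power_add)
    also have "\<dots> \<le> 2 * (x * (phi (log 2 x) * 2 ^ log_star (log 2 x)))"
      using pow IH x by (intro mult_left_mono mult_mono) auto
    also have "\<dots> = phi x * 2 ^ log_star x"
      using x by (simp add: phi.simps[of x] log_star_step)
    finally show ?thesis .
  qed
qed

theorem theorem3:
  fixes P :: "'a set" and E :: "'a set set" and col :: "'a \<Rightarrow> nat"
    and p :: 'a and c s :: nat
  assumes "finite_graph P E"
    and "legal_coloring P E col"
    and "p \<in> P" and "col p = c"
    and "s \<ge> 1"
  shows "\<exists>i\<in>{s..<s + nat \<lfloor>phi (real c) * 2 ^ (log_star (real c) + 1)\<rfloor>}. happy col p i"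
proof -
  let ?N = "nat \<lfloor>phi (real c) * 2 ^ (log_star (real c) + 1)\<rfloor>"
  let ?L = "length (omega c)"
  \<comment> \<open>The \<open>+ 1\<close> in the exponent accounts for the final 0 of
    \<open>omega c\<close>.\<close>
  have "real (2 ^ ?L) \<le> phi (real c) * 2 ^ (log_star (real c) + 1)"
    using two_power_length_elias_re_le[of c "real c"] by (simp add: omega_def)
  \<comment> \<open>The left side is an integer, so rounding the bound down loses nothing.\<close>
  then have bound: "2 ^ ?L \<le> ?N"
    by (simp only: le_nat_floor)
  obtain r where r: "r < 2 ^ ?L"
    and bits: "\<And>i. i mod 2 ^ ?L = r \<Longrightarrow> least_significant_bits ?L i = rev (omega c)"
    using least_significant_bits_eq_if_mod[of "rev (omega c)"] by auto
  obtain i where i: "i \<in> {s..<s + 2 ^ ?L}" "i mod 2 ^ ?L = r"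
    using ex_mod_eq_in_interval[OF r] by blast
  from i(2) have "happy col p i"
    using bits \<open>col p = c\<close> by (simp add: happy_def)
  moreover have "i \<in> {s..<s + ?N}"
    using i(1) bound unfolding atLeastLessThan_iff by linarith
  ultimately show ?thesis by blast
qed

end
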